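(* Let $L$ be a complete lattice. Then its Scott space $\Sigma L$ is a strong $R$-space.
   Context: A subset $U$ of a poset $L$ is Scott open if it is an upper set and, for every directed $D\subseteq L$ whose supremum exists, $\bigvee D\in U$ implies $D\cap U\neq\emptyset$; $\Sigma L$ is $L$ with the topology of Scott open sets. For a $T_0$-space $X$, a subset is saturated if it equals the intersection of all open sets containing it, and $Q(X)$ is the set of all nonempty compact saturated subsets of $X$ (compactness is the open-cover property). A $T_0$-space $X$ is a strong $R$-space if for every nonempty family $\{K_i: i\in I\}\subseteq Q(X)$ and every open $U\subseteq X$, $\bigcap_{i\in I}K_i\subseteq U$ implies $\bigcap_{i\in J}K_i\subseteq U$ for some nonempty finite $J\subseteq I$. *)

theory Defs
  imports "HOL-Analysis.Analysis" "HOL-Library.Lub_Glb"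
begin

text \<open>Directed sets are nonempty by convention. With the empty set admitted, the whole space
  of a poset with a least element would not be Scott open.\<close>

definition directed_set :: "'a::order set \<Rightarrow> bool" where
  "directed_set D \<longleftrightarrow> D \<noteq> {} \<and> (\<forall>x\<in>D. \<forall>y\<in>D. \<exists>z\<in>D. x \<le> z \<and> y \<le> z)"

definition scott_open :: "'a::order set \<Rightarrow> bool" where
  "scott_open U \<longleftrightarrow>
     (\<forall>x\<in>U. \<forall>y. x \<le> y \<longrightarrow> y \<in> U) \<and>
     (\<forall>D s. directed_set D \<longrightarrow> isLub UNIV D s \<longrightarrow> s \<in> U \<longrightarrow> D \<inter> U \<noteq> {})"

definition scott_space :: "'a::order topology" where
  "scott_space = topology scott_open"

lemma scott_openI:
  assumes "\<And>x y. x \<in> U \<Longrightarrow> x \<le> y \<Longrightarrow> y \<in> U"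
    and "\<And>D s. directed_set D \<Longrightarrow> isLub UNIV D s \<Longrightarrow> s \<in> U \<Longrightarrow> \<exists>d\<in>D. d \<in> U"
  shows "scott_open U"
  using assms unfolding scott_open_def disjoint_iff by metis

lemma scott_open_upward: "scott_open U \<Longrightarrow> x \<in> U \<Longrightarrow> x \<le> y \<Longrightarrow> y \<in> U"
  unfolding scott_open_def by metis

lemma scott_open_directed:
  assumes "scott_open U" "directed_set D" "isLub UNIV D s" "s \<in> U"
  obtains d where "d \<in> D" "d \<in> U"
  using assms unfolding scott_open_def disjoint_iff by metis

lemma istopology_scott_open: "istopology (scott_open :: 'a::order set \<Rightarrow> bool)"
  unfolding istopology_def
proof (intro conjI allI impI)
  fix S T :: "'a set"
  assume S: "scott_open S" and T: "scott_open T"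
  show "scott_open (S \<inter> T)"
  proof (rule scott_openI)
    fix x y assume "x \<in> S \<inter> T" "x \<le> y"
    then show "y \<in> S \<inter> T"
      using scott_open_upward[OF S] scott_open_upward[OF T] by auto
  next
    fix D s assume D: "directed_set D" "isLub UNIV D s" "s \<in> S \<inter> T"
    obtain x where x: "x \<in> D" "x \<in> S"
      using scott_open_directed[OF S D(1,2)] D(3) by auto
    obtain y where y: "y \<in> D" "y \<in> T"
      using scott_open_directed[OF T D(1,2)] D(3) by auto
    obtain z where z: "z \<in> D" "x \<le> z" "y \<le> z"
      using D(1) x(1) y(1) unfolding directed_set_def by metis
    then show "\<exists>d\<in>D. d \<in> S \<inter> T"
      using scott_open_upward[OF S x(2)] scott_open_upward[OF T y(2)] by auto
  qed
next
  fix \<K> :: "'a set set"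
  assume K: "\<forall>K\<in>\<K>. scott_open K"
  show "scott_open (\<Union>\<K>)"
  proof (rule scott_openI)
    fix x y assume "x \<in> \<Union>\<K>" "x \<le> y"
    then show "y \<in> \<Union>\<K>"
      using K scott_open_upward by (metis Union_iff)
  next
    fix D s assume D: "directed_set D" "isLub UNIV D s" "s \<in> \<Union>\<K>"
    then obtain U where U: "U \<in> \<K>" "s \<in> U"
      by auto
    obtain d where "d \<in> D" "d \<in> U"
      using scott_open_directed[of U D s] K D(1,2) U by auto
    then show "\<exists>d\<in>D. d \<in> \<Union>\<K>"
      using U(1) by auto
  qed
qed

lemma openin_scott_space [simp]: "openin scott_space U \<longleftrightarrow> scott_open U"
  by (simp add: scott_space_def istopology_scott_open)

lemma topspace_scott_space [simp]: "topspace (scott_space :: 'a::order topology) = UNIV"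
proof -
  have "scott_open (UNIV :: 'a set)"
    by (auto simp: scott_open_def directed_set_def)
  then show ?thesis
    by (metis openin_scott_space openin_subset top.extremum_uniqueI)
qed

definition saturated_in :: "'a topology \<Rightarrow> 'a set \<Rightarrow> bool" where
  "saturated_in X A \<longleftrightarrow> A \<subseteq> topspace X \<and> A = \<Inter>{U. openin X U \<and> A \<subseteq> U}"

definition compact_saturated_sets :: "'a topology \<Rightarrow> 'a set set" where
  "compact_saturated_sets X = {K. K \<noteq> {} \<and> compactin X K \<and> saturated_in X K}"

text \<open>A family \<open>(K i)\<close> indexed by \<open>I\<close> is represented by the set \<open>\<K>\<close> of its members: the
  intersections only depend on this set, and the finite nonempty subfamilies of the indexed
  family have as sets of members exactly the finite nonempty subsets of \<open>\<K>\<close>.\<close>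

definition strong_R_space :: "'a topology \<Rightarrow> bool" where
  "strong_R_space X \<longleftrightarrow>
     t0_space X \<and>
     (\<forall>\<K> U. \<K> \<noteq> {} \<longrightarrow> \<K> \<subseteq> compact_saturated_sets X \<longrightarrow> openin X U \<longrightarrow> \<Inter>\<K> \<subseteq> U \<longrightarrow>
        (\<exists>\<J>. \<J> \<noteq> {} \<and> finite \<J> \<and> \<J> \<subseteq> \<K> \<and> \<Inter>\<J> \<subseteq> U))"

end

theory Submission
  imports Defs
begin

text \<open>
  For open \<open>U\<close> and compact \<open>K\<close> the set \<open>{x. \<forall>y\<in>K. sup x y \<in> U}\<close> is again Scott open; this
  makes finite intersections of compact upper sets compact, so only filtered families remain.
  If no member of a filtered family lies in \<open>U\<close>, Zorn's lemma enlarges \<open>U\<close> to a maximal such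
  open set \<open>M\<close>. The same construction, applied to \<open>M\<close> and maximality, shows that the complement
  of \<open>M\<close> is closed under joins. Hence it has a greatest element, which lies in every member of
  the family but not in \<open>U\<close>.
\<close>

section \<open>Compactness in terms of directed open covers\<close>

lemma directed_Union_bound:
  assumes "finite \<F>" "\<F> \<subseteq> \<U>" "\<U> \<noteq> {}"
    and "\<And>U V. U \<in> \<U> \<Longrightarrow> V \<in> \<U> \<Longrightarrow> \<exists>W\<in>\<U>. U \<union> V \<subseteq> W"
  shows "\<exists>W\<in>\<U>. \<Union>\<F> \<subseteq> W"
  using assms(1,2)
proof (induction \<F> rule: finite_induct)
  case empty
  then show ?case using assms(3) by auto
next
  case (insert A \<F>)
  then obtain W where "W \<in> \<U>" "\<Union>\<F> \<subseteq> W" by auto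
  moreover obtain W' where "W' \<in> \<U>" "A \<union> W \<subseteq> W'"
    using assms(4)[of A W] insert.prems \<open>W \<in> \<U>\<close> by auto
  ultimately show ?case by (intro bexI[of _ W']) auto
qed

text \<open>A directed family has a member above any finite subfamily, and conversely the finite
  unions from a cover form a directed cover. Extracting one member, not finitely many, suits the
  Scott topology, where a single element of a directed set has to be found.\<close>

lemma compactin_directed:
  "compactin X K \<longleftrightarrow> K \<subseteq> topspace X \<and>
     (\<forall>\<U>. \<U> \<noteq> {} \<longrightarrow> (\<forall>U\<in>\<U>. openin X U) \<longrightarrow> (\<forall>U\<in>\<U>. \<forall>V\<in>\<U>. \<exists>W\<in>\<U>. U \<union> V \<subseteq> W) \<longrightarrow>
        K \<subseteq> \<Union>\<U> \<longrightarrow> (\<exists>U\<in>\<U>. K \<subseteq> U))" (is "_ \<longleftrightarrow> ?R")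
proof
  assume K: "compactin X K"
  have "\<exists>U\<in>\<U>. K \<subseteq> U"
    if \<U>: "\<U> \<noteq> {}" "\<forall>U\<in>\<U>. openin X U" "\<forall>U\<in>\<U>. \<forall>V\<in>\<U>. \<exists>W\<in>\<U>. U \<union> V \<subseteq> W" "K \<subseteq> \<Union>\<U>" for \<U>
  proof -
    obtain \<F> where \<F>: "finite \<F>" "\<F> \<subseteq> \<U>" "K \<subseteq> \<Union>\<F>"
      using compactinD[OF K, of \<U>] \<U> by auto
    have "\<exists>W\<in>\<U>. \<Union>\<F> \<subseteq> W"
      by (rule directed_Union_bound[OF \<F>(1,2) \<U>(1)]) (use \<U>(3) in metis)
    then show ?thesis using \<F>(3) by auto
  qed
  then show ?R using compactin_subset_topspace[OF K] by blast
next
  assume R: ?R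
  show "compactin X K"
    unfolding compactin_def
  proof (intro conjI allI impI)
    show "K \<subseteq> topspace X" using R by blast
    fix \<U> assume \<U>: "Ball \<U> (openin X) \<and> K \<subseteq> \<Union>\<U>"
    let ?D = "Union ` {\<F>. finite \<F> \<and> \<F> \<subseteq> \<U>}"
    have directed: "\<forall>U\<in>?D. \<forall>V\<in>?D. \<exists>W\<in>?D. U \<union> V \<subseteq> W"
    proof (intro ballI)
      fix U V assume "U \<in> ?D" "V \<in> ?D"
      then obtain F G where FG: "finite F" "F \<subseteq> \<U>" "U = \<Union>F" "finite G" "G \<subseteq> \<U>" "V = \<Union>G"
        by auto
      then have "\<Union>(F \<union> G) \<in> ?D" by (intro imageI) auto
      then show "\<exists>W\<in>?D. U \<union> V \<subseteq> W" using FG by (intro bexI[of _ "\<Union>(F \<union> G)"]) auto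
    qed
    have opens: "\<forall>U\<in>?D. openin X U" using \<U> by auto
    have cover: "K \<subseteq> \<Union>?D"
    proof
      fix x assume "x \<in> K"
      then obtain U where "U \<in> \<U>" "x \<in> U" using \<U> by auto
      moreover from this have "\<Union>{U} \<in> ?D" by (intro imageI) auto
      ultimately show "x \<in> \<Union>?D" by auto
    qed
    have "?D \<noteq> {}" by auto
    then have "\<exists>U\<in>?D. K \<subseteq> U"
      by (rule R[THEN conjunct2, THEN spec, THEN mp, THEN mp, THEN mp, THEN mp,
            OF _ opens directed cover])
    then show "\<exists>\<F>. finite \<F> \<and> \<F> \<subseteq> \<U> \<and> K \<subseteq> \<Union>\<F>" by auto
  qed
qed

lemma compactin_directedD:
  assumes "compactin X K" "\<U> \<noteq> {}" "\<And>U. U \<in> \<U> \<Longrightarrow> openin X U"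
    and "\<And>U V. U \<in> \<U> \<Longrightarrow> V \<in> \<U> \<Longrightarrow> \<exists>W\<in>\<U>. U \<union> V \<subseteq> W" "K \<subseteq> \<Union>\<U>"
  obtains U where "U \<in> \<U>" "K \<subseteq> U"
proof -
  have "\<exists>U\<in>\<U>. K \<subseteq> U"
    using assms(1)[unfolded compactin_directed] assms(2-5) by simp
  then show ?thesis using that by blast
qed

section \<open>Binary joins and Scott open sets\<close>

lemma isLub_UNIV_iff: "isLub UNIV D s \<longleftrightarrow> s = Sup D" for s :: "'a::complete_lattice"
proof
  assume "isLub UNIV D s"
  then have "\<And>d. d \<in> D \<Longrightarrow> d \<le> s" "\<And>u. (\<And>d. d \<in> D \<Longrightarrow> d \<le> u) \<Longrightarrow> s \<le> u"
    by (auto simp: isLub_def leastP_def isUb_def setle_def setge_def)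
  then show "s = Sup D" by (metis Sup_least Sup_upper order_antisym)
qed (auto simp: isLub_def leastP_def isUb_def setle_def setge_def Sup_upper Sup_least)

text \<open>Distributivity is not involved: both sides are the least upper bound of \<open>D\<close>
  together with \<open>x\<close>. For empty \<open>D\<close> they would be \<open>x\<close> and the
  least element.\<close>

lemma sup_Sup_eq_Sup_image:
  fixes x :: "'a::complete_lattice"
  assumes "D \<noteq> {}"
  shows "sup x (Sup D) = Sup (sup x ` D)"
proof (rule order_antisym)
  obtain d where "d \<in> D" using assms by auto
  then have "x \<le> Sup (sup x ` D)" by (meson SUP_upper2 sup_ge1)
  moreover have "Sup D \<le> Sup (sup x ` D)" by (meson SUP_upper2 Sup_least sup_ge2)
  ultimately show "sup x (Sup D) \<le> Sup (sup x ` D)" by simp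
  show "Sup (sup x ` D) \<le> sup x (Sup D)"
    by (rule SUP_least) (simp add: Sup_upper le_supI2)
qed

lemma directed_sup_image:
  fixes x :: "'a::complete_lattice"
  assumes "directed_set D"
  shows "directed_set (sup x ` D)"
  unfolding directed_set_def
proof (intro conjI ballI)
  show "sup x ` D \<noteq> {}" using assms by (simp add: directed_set_def)
  fix u v assume "u \<in> sup x ` D" "v \<in> sup x ` D"
  then obtain a b where ab: "a \<in> D" "b \<in> D" "u = sup x a" "v = sup x b" by auto
  then obtain c where "c \<in> D" "a \<le> c" "b \<le> c" using assms unfolding directed_set_def by meson
  then show "\<exists>w\<in>sup x ` D. u \<le> w \<and> v \<le> w"
    using ab by (intro bexI[of _ "sup x c"]) (auto intro: le_supI2)
qed

text \<open>The map \<open>sup x\<close> preserves directed joins, so it is Scott continuous, and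
  the set is a preimage of \<open>U\<close>.\<close>

lemma scott_open_sup:
  fixes x :: "'a::complete_lattice"
  assumes U: "scott_open U"
  shows "scott_open {y. sup x y \<in> U}"
proof (rule scott_openI)
  fix y z assume "y \<in> {y. sup x y \<in> U}" "y \<le> z"
  then show "z \<in> {y. sup x y \<in> U}"
    by (auto intro: scott_open_upward[OF U _ sup_mono])
next
  fix D s assume D: "directed_set D" "isLub UNIV D s" "s \<in> {y. sup x y \<in> U}"
  have "Sup (sup x ` D) \<in> U"
    using D sup_Sup_eq_Sup_image[of D x] by (auto simp: isLub_UNIV_iff directed_set_def)
  then obtain e where "e \<in> sup x ` D" "e \<in> U"
    using scott_open_directed[OF U directed_sup_image[OF D(1)]] isLub_UNIV_iff by metis
  then show "\<exists>d\<in>D. d \<in> {y. sup x y \<in> U}" by auto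
qed

text \<open>If the join of a directed \<open>D\<close> belongs to the set, the open sets
  \<open>{y. sup d y \<in> U}\<close> with \<open>d\<close> in \<open>D\<close> form a directed
  cover of \<open>K\<close>. A member that contains all of \<open>K\<close> gives the required
  \<open>d\<close>.\<close>

lemma scott_open_sup_compact:
  fixes K :: "'a::complete_lattice set"
  assumes U: "scott_open U" and K: "compactin scott_space K"
  shows "scott_open {x. \<forall>y\<in>K. sup x y \<in> U}"
proof (rule scott_openI)
  fix x z assume "x \<in> {x. \<forall>y\<in>K. sup x y \<in> U}" "x \<le> z"
  then show "z \<in> {x. \<forall>y\<in>K. sup x y \<in> U}"
    by (auto intro: scott_open_upward[OF U _ sup_mono])
next
  fix D s assume D: "directed_set D" "isLub UNIV D s" "s \<in> {x. \<forall>y\<in>K. sup x y \<in> U}"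
  let ?V = "\<lambda>d. {y. sup d y \<in> U}"
  obtain V where V: "V \<in> ?V ` D" "K \<subseteq> V"
  proof (rule compactin_directedD[OF K])
    show "?V ` D \<noteq> {}" using D by (auto simp: directed_set_def)
    show "openin scott_space V" if "V \<in> ?V ` D" for V
      using that scott_open_sup[OF U] by auto
    show "\<exists>W\<in>?V ` D. A \<union> B \<subseteq> W" if "A \<in> ?V ` D" "B \<in> ?V ` D" for A B
    proof -
      obtain a b where ab: "a \<in> D" "b \<in> D" "A = ?V a" "B = ?V b" using \<open>A \<in> _\<close> \<open>B \<in> _\<close> by auto
      then obtain c where c: "c \<in> D" "a \<le> c" "b \<le> c"
        using D(1) unfolding directed_set_def by meson
      have "A \<union> B \<subseteq> ?V c"
        using ab c scott_open_upward[OF U] by (auto intro: sup_mono)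
      then show ?thesis using c(1) by auto
    qed
    show "K \<subseteq> \<Union>(?V ` D)"
    proof
      fix y assume "y \<in> K"
      then have "sup s y \<in> U" using D(3) by auto
      \<comment> \<open>With \<open>y\<close> fixed and \<open>s\<close> as the variable, openness
        in the other argument replaces \<open>s\<close> by some \<open>d\<close> in
        \<open>D\<close>.\<close>
      then have "s \<in> {x. sup y x \<in> U}" by (metis mem_Collect_eq sup_commute)
      then obtain d where "d \<in> D" "d \<in> {x. sup y x \<in> U}"
        using scott_open_directed[OF scott_open_sup[OF U] D(1,2)] by blast
      then show "y \<in> \<Union>(?V ` D)" by (auto simp: sup_commute)
    qed
  qed
  then show "\<exists>d\<in>D. d \<in> {x. \<forall>y\<in>K. sup x y \<in> U}" by auto
qed

section \<open>Finite intersections of compact upper sets\<close>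

definition upper_set :: "'a::order set \<Rightarrow> bool" where
  "upper_set A \<longleftrightarrow> (\<forall>x\<in>A. \<forall>y. x \<le> y \<longrightarrow> y \<in> A)"

lemma saturated_in_scott_imp_upper:
  assumes "saturated_in scott_space K"
  shows "upper_set K"
  unfolding upper_set_def
proof (intro ballI allI impI)
  fix x y assume "x \<in> K" "x \<le> y"
  then have "y \<in> \<Inter>{U. openin scott_space U \<and> K \<subseteq> U}"
    by (auto intro: scott_open_upward)
  then show "y \<in> K" using assms unfolding saturated_in_def by blast
qed

text \<open>The join maps pairs from \<open>K\<close> and \<open>L\<close> into
  \<open>K \<inter> L\<close>, and each \<open>x\<close> in \<open>K \<inter> L\<close> is
  \<open>sup x x\<close>. So it suffices to find one \<open>U\<close> that contains all these joins.
  Compactness of \<open>L\<close> gives such a \<open>U\<close> for each fixed \<open>x\<close> in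
  \<open>K\<close>, and compactness of \<open>K\<close> then makes it uniform in
  \<open>x\<close>.\<close>

lemma compactin_scott_Int:
  fixes K L :: "'a::complete_lattice set"
  assumes K: "compactin scott_space K" "upper_set K" and L: "compactin scott_space L" "upper_set L"
  shows "compactin scott_space (K \<inter> L)"
  unfolding compactin_directed
proof (intro conjI allI impI)
  show "K \<inter> L \<subseteq> topspace scott_space" by simp
  fix \<U> :: "'a set set"
  assume \<U>: "\<U> \<noteq> {}" "\<forall>U\<in>\<U>. openin scott_space U" "\<forall>U\<in>\<U>. \<forall>V\<in>\<U>. \<exists>W\<in>\<U>. U \<union> V \<subseteq> W"
    "K \<inter> L \<subseteq> \<Union>\<U>"
  let ?W = "\<lambda>U. {x. \<forall>y\<in>L. sup x y \<in> U}"
  obtain W where W: "W \<in> ?W ` \<U>" "K \<subseteq> W"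
  proof (rule compactin_directedD[OF K(1)])
    show "?W ` \<U> \<noteq> {}" using \<U>(1) by auto
    show "openin scott_space V" if "V \<in> ?W ` \<U>" for V
      using that \<U>(2) scott_open_sup_compact[OF _ L(1)] by auto
    show "\<exists>W\<in>?W ` \<U>. A \<union> B \<subseteq> W" if AB: "A \<in> ?W ` \<U>" "B \<in> ?W ` \<U>" for A B
    proof -
      obtain U V where UV: "U \<in> \<U>" "V \<in> \<U>" "A = ?W U" "B = ?W V" using AB by auto
      then obtain T where "T \<in> \<U>" "U \<union> V \<subseteq> T" using \<U>(3) by blast
      then show ?thesis using UV by (intro bexI[of _ "?W T"]) auto
    qed
    show "K \<subseteq> \<Union>(?W ` \<U>)"
    proof
      fix x assume "x \<in> K"
      let ?V = "\<lambda>U. {y. sup x y \<in> U}"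
      obtain V where V: "V \<in> ?V ` \<U>" "L \<subseteq> V"
      proof (rule compactin_directedD[OF L(1)])
        show "?V ` \<U> \<noteq> {}" using \<U>(1) by auto
        show "openin scott_space V" if "V \<in> ?V ` \<U>" for V
          using that \<U>(2) scott_open_sup by auto
        show "\<exists>W\<in>?V ` \<U>. A \<union> B \<subseteq> W" if AB: "A \<in> ?V ` \<U>" "B \<in> ?V ` \<U>" for A B
        proof -
          obtain U V where UV: "U \<in> \<U>" "V \<in> \<U>" "A = ?V U" "B = ?V V" using AB by auto
          then obtain T where "T \<in> \<U>" "U \<union> V \<subseteq> T" using \<U>(3) by blast
          then show ?thesis using UV by (intro bexI[of _ "?V T"]) auto
        qed
        show "L \<subseteq> \<Union>(?V ` \<U>)"
        proof
          fix y assume "y \<in> L"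
          then have "sup x y \<in> K \<inter> L"
            using \<open>x \<in> K\<close> K(2) L(2) unfolding upper_set_def by (meson IntI sup_ge1 sup_ge2)
          then show "y \<in> \<Union>(?V ` \<U>)" using \<U>(4) by auto
        qed
      qed
      then show "x \<in> \<Union>(?W ` \<U>)" by auto
    qed
  qed
  then obtain U where U: "U \<in> \<U>" "W = ?W U" by auto
  \<comment> \<open>Restriction to the diagonal: \<open>sup x x\<close> is \<open>x\<close>.\<close>
  have "sup x x \<in> U" if "x \<in> K \<inter> L" for x using that U(2) W(2) by blast
  then show "\<exists>U\<in>\<U>. K \<inter> L \<subseteq> U" using U(1) by auto
qed

lemma compactin_scott_Inter:
  fixes \<J> :: "'a::complete_lattice set set"
  assumes "finite \<J>" "\<J> \<noteq> {}" "\<And>K. K \<in> \<J> \<Longrightarrow> compactin scott_space K \<and> upper_set K"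
  shows "compactin scott_space (\<Inter>\<J>)"
  using assms
proof (induction \<J> rule: finite_ne_induct)
  case (insert K \<J>)
  have "upper_set (\<Inter>\<J>)" using insert.prems unfolding upper_set_def by blast
  then show ?case using insert compactin_scott_Int[of K "\<Inter>\<J>"] by auto
qed auto

section \<open>Filtered families of compact upper sets\<close>

lemma scott_well_filtered:
  fixes \<F> :: "'a::complete_lattice set set"
  assumes ne: "\<F> \<noteq> {}"
    and \<F>: "\<And>K. K \<in> \<F> \<Longrightarrow> compactin scott_space K" "\<And>K. K \<in> \<F> \<Longrightarrow> upper_set K"
    and filt: "\<And>K L. K \<in> \<F> \<Longrightarrow> L \<in> \<F> \<Longrightarrow> \<exists>M\<in>\<F>. M \<subseteq> K \<inter> L"
    and U: "scott_open U" "\<Inter>\<F> \<subseteq> U"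
  shows "\<exists>K\<in>\<F>. K \<subseteq> U"
proof (rule ccontr)
  assume neg: "\<not> (\<exists>K\<in>\<F>. K \<subseteq> U)"
  let ?A = "{V. scott_open V \<and> U \<subseteq> V \<and> (\<forall>K\<in>\<F>. \<not> K \<subseteq> V)}"
  have UA: "U \<in> ?A" using neg U(1) by auto
  have "\<exists>M\<in>?A. \<forall>V\<in>?A. M \<subseteq> V \<longrightarrow> V = M"
  proof (rule subset_Zorn_nonempty)
    show "?A \<noteq> {}" using UA by blast
    fix \<C> assume \<C>: "\<C> \<noteq> {}" "subset.chain ?A \<C>"
    then have sub: "\<C> \<subseteq> ?A" and lin: "\<And>V W. V \<in> \<C> \<Longrightarrow> W \<in> \<C> \<Longrightarrow> V \<subseteq> W \<or> W \<subseteq> V"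
      by (auto simp: subset_chain_def)
    have op: "openin scott_space V" if "V \<in> \<C>" for V using that sub by auto
    \<comment> \<open>A chain is directed, so a compact set inside its union lies inside one of its
      members.\<close>
    have "\<not> K \<subseteq> \<Union>\<C>" if K: "K \<in> \<F>" for K
    proof
      assume cover: "K \<subseteq> \<Union>\<C>"
      have "\<exists>T\<in>\<C>. V \<union> W \<subseteq> T" if "V \<in> \<C>" "W \<in> \<C>" for V W
        using lin[OF that] that by (metis Un_least order_refl)
      then obtain V where "V \<in> \<C>" "K \<subseteq> V"
        using compactin_directedD[OF \<F>(1)[OF K] \<C>(1) op _ cover] by metis
      then show False using sub K by auto
    qed
    moreover have "scott_open (\<Union>\<C>)" using openin_Union[of \<C> scott_space] op by auto
    moreover have "U \<subseteq> \<Union>\<C>" using \<C>(1) sub by blast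
    ultimately show "\<Union>\<C> \<in> ?A" by auto
  qed
  then obtain M where M: "scott_open M" "U \<subseteq> M" "\<And>K. K \<in> \<F> \<Longrightarrow> \<not> K \<subseteq> M"
    and M_max: "\<forall>V\<in>?A. M \<subseteq> V \<longrightarrow> V = M"
    by auto
  have max: "V = M" if "scott_open V" "M \<subseteq> V" "\<And>K. K \<in> \<F> \<Longrightarrow> \<not> K \<subseteq> V" for V
    by (rule M_max[rule_format]) (use that M(2) in auto)
  have M_up: "sup x y \<in> M" if "x \<in> M \<or> y \<in> M" for x y
    using that scott_open_upward[OF M(1)] by (meson sup_ge1 sup_ge2)
  let ?W = "\<lambda>K. {x. \<forall>y\<in>K. sup x y \<in> M}"
  have W_open: "openin scott_space (?W K)" if "K \<in> \<F>" for K
    using scott_open_sup_compact[OF M(1) \<F>(1)[OF that]] by simp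
  \<comment> \<open>\<open>?W K\<close> grows as \<open>K\<close> shrinks, so filteredness of
    \<open>\<F>\<close> makes these open sets directed. If their union contained some
    \<open>K\<close>, compactness would give \<open>K \<subseteq> ?W L\<close>, and a member
    \<open>H\<close> of \<open>\<F>\<close> inside \<open>K \<inter> L\<close> would lie in
    \<open>M\<close> because \<open>x\<close> is \<open>sup x x\<close>. Maximality of
    \<open>M\<close> therefore applies.\<close>
  have W_eq: "\<Union>(?W ` \<F>) = M"
  proof (rule max)
    have "openin scott_space (\<Union>(?W ` \<F>))" by (rule openin_Union) (use W_open in blast)
    then show "scott_open (\<Union>(?W ` \<F>))" by simp
    show "M \<subseteq> \<Union>(?W ` \<F>)" using ne M_up by auto
    fix K assume K: "K \<in> \<F>"
    show "\<not> K \<subseteq> \<Union>(?W ` \<F>)"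
    proof
      assume cover: "K \<subseteq> \<Union>(?W ` \<F>)"
      obtain W where W: "W \<in> ?W ` \<F>" "K \<subseteq> W"
      proof (rule compactin_directedD[OF \<F>(1)[OF K] _ _ _ cover])
        show "?W ` \<F> \<noteq> {}" using ne by auto
        show "openin scott_space V" if "V \<in> ?W ` \<F>" for V using that W_open by blast
        show "\<exists>C\<in>?W ` \<F>. A \<union> B \<subseteq> C" if AB: "A \<in> ?W ` \<F>" "B \<in> ?W ` \<F>" for A B
        proof -
          obtain I J where IJ: "I \<in> \<F>" "J \<in> \<F>" "A = ?W I" "B = ?W J" using AB by auto
          then obtain H where "H \<in> \<F>" "H \<subseteq> I \<inter> J" using filt by blast
          then show ?thesis using IJ by (intro bexI[of _ "?W H"]) auto
        qed
      qed
      then obtain L where L: "L \<in> \<F>" "K \<subseteq> ?W L" by auto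
      obtain H where H: "H \<in> \<F>" "H \<subseteq> K \<inter> L" using filt K L(1) by blast
      have "sup x x \<in> M" if "x \<in> H" for x using that H(2) L(2) by blast
      then show False using M(3)[OF H(1)] by auto
    qed
  qed
  \<comment> \<open>If the open set \<open>{z. sup x z \<in> M}\<close> contained some
    \<open>K\<close> in \<open>\<F>\<close>, then \<open>x\<close> would be in \<open>?W K\<close>,
    hence in \<open>M\<close> by \<open>W_eq\<close>. So maximality identifies this set with
    \<open>M\<close>, and \<open>y\<close> is not in it.\<close>
  have prime: "sup x y \<notin> M" if "x \<notin> M" "y \<notin> M" for x y
  proof -
    have "{z. sup x z \<in> M} = M"
    proof (rule max[OF scott_open_sup[OF M(1)]])
      show "M \<subseteq> {z. sup x z \<in> M}" using M_up by auto
      show "\<not> K \<subseteq> {z. sup x z \<in> M}" if "K \<in> \<F>" for K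
      proof
        assume "K \<subseteq> {z. sup x z \<in> M}"
        then have "x \<in> ?W K" by auto
        then have "x \<in> \<Union>(?W ` \<F>)" using that by (rule UN_I[rotated])
        then show False using \<open>x \<notin> M\<close> W_eq by simp
      qed
    qed
    then show ?thesis using \<open>y \<notin> M\<close> by auto
  qed
  have "- M \<noteq> {}" using ne M(3) by auto
  then have "directed_set (- M)"
    unfolding directed_set_def using prime by (meson ComplD ComplI sup_ge1 sup_ge2)
  \<comment> \<open>If this join were in \<open>M\<close>, Scott openness would make the directed
    set \<open>- M\<close> meet \<open>M\<close>.\<close>
  then have top: "Sup (- M) \<notin> M"
    using scott_open_directed[OF M(1), of "- M" "Sup (- M)"] by (auto simp: isLub_UNIV_iff)
  \<comment> \<open>Each \<open>K\<close> has a point outside \<open>M\<close>; it lies below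
    \<open>Sup (- M)\<close>, and \<open>K\<close> is an upper set.\<close>
  have "Sup (- M) \<in> K" if K: "K \<in> \<F>" for K
  proof -
    obtain x where "x \<in> K" "x \<in> - M" using M(3)[OF K] by auto
    then show ?thesis using \<F>(2)[OF K] unfolding upper_set_def by (meson Sup_upper)
  qed
  then show False using top U(2) M(2) by blast
qed

section \<open>T0 separation and the strong R property\<close>

lemma t0_scott_space: "t0_space (scott_space :: 'a::order topology)"
proof -
  \<comment> \<open>If every element of \<open>D\<close> were below \<open>y\<close>, so would be
    the least upper bound of \<open>D\<close>.\<close>
  have op: "scott_open {z. \<not> z \<le> y}" for y :: 'a
  proof (rule scott_openI)
    fix D s assume D: "isLub UNIV D s" "s \<in> {z. \<not> z \<le> y}"
    show "\<exists>d\<in>D. d \<in> {z. \<not> z \<le> y}"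
      using D by (auto simp: isLub_def leastP_def isUb_def setle_def setge_def)
  qed auto
  show ?thesis
    unfolding t0_space_def
  proof (intro ballI impI)
    fix x y :: 'a assume "x \<noteq> y"
    then have "\<not> x \<le> y \<or> \<not> y \<le> x" by auto
    then show "\<exists>U. openin scott_space U \<and> (x \<notin> U) = (y \<in> U)"
    proof
      assume "\<not> x \<le> y"
      then show ?thesis using op[of y] by (intro exI[of _ "{z. \<not> z \<le> y}"]) auto
    next
      assume "\<not> y \<le> x"
      then show ?thesis using op[of x] by (intro exI[of _ "{z. \<not> z \<le> x}"]) auto
    qed
  qed
qed

theorem proposition4p6:
  shows "strong_R_space (scott_space :: 'a::complete_lattice topology)"
  unfolding strong_R_space_def
proof (intro conjI allI impI)
  show "t0_space (scott_space :: 'a topology)" by (rule t0_scott_space)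
  fix \<K> :: "'a set set" and U
  assume \<K>: "\<K> \<noteq> {}" "\<K> \<subseteq> compact_saturated_sets scott_space"
    and U: "openin scott_space U" "\<Inter>\<K> \<subseteq> U"
  \<comment> \<open>The intersections of these subfamilies form a filtered family, since
    intersecting two of them corresponds to the union of the subfamilies. The singletons keep its
    total intersection inside \<open>U\<close>, and a member inside \<open>U\<close> is the required
    finite intersection.\<close>
  let ?\<I> = "{\<J>. \<J> \<noteq> {} \<and> finite \<J> \<and> \<J> \<subseteq> \<K>}"
  have K: "compactin scott_space K \<and> upper_set K" if "K \<in> \<K>" for K
    using that \<K>(2) saturated_in_scott_imp_upper by (auto simp: compact_saturated_sets_def)
  have sing: "{K} \<in> ?\<I>" if "K \<in> \<K>" for K using that by auto
  have "\<exists>A\<in>Inter ` ?\<I>. A \<subseteq> U"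
  proof (rule scott_well_filtered)
    show "Inter ` ?\<I> \<noteq> {}" using \<K>(1) sing by blast
    show "scott_open U" using U(1) by simp
    show "\<Inter>(Inter ` ?\<I>) \<subseteq> U"
    proof
      fix x assume "x \<in> \<Inter>(Inter ` ?\<I>)"
      then have "x \<in> \<Inter>{K}" if "K \<in> \<K>" for K using sing[OF that] by (rule INT_D)
      then show "x \<in> U" using U(2) by auto
    qed
  next
    fix A assume "A \<in> Inter ` ?\<I>"
    then obtain \<J> where "\<J> \<in> ?\<I>" and A: "A = \<Inter>\<J>" by (rule imageE) simp
    then have \<J>: "\<J> \<noteq> {}" "finite \<J>" "\<J> \<subseteq> \<K>" by auto
    have K\<J>: "compactin scott_space K \<and> upper_set K" if "K \<in> \<J>" for K
      using K \<J>(3) that by auto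
    show "compactin scott_space A"
      unfolding A by (rule compactin_scott_Inter[OF \<J>(2,1) K\<J>])
    show "upper_set A" using K\<J> unfolding upper_set_def A by blast
  next
    fix A B assume "A \<in> Inter ` ?\<I>" "B \<in> Inter ` ?\<I>"
    then obtain I J where IJ: "I \<in> ?\<I>" "J \<in> ?\<I>" "A = \<Inter>I" "B = \<Inter>J" by (elim imageE)
    then have "I \<union> J \<in> ?\<I>" by auto
    then show "\<exists>C\<in>Inter ` ?\<I>. C \<subseteq> A \<inter> B" 
      unfolding IJ(3,4) by (intro bexI[of _ "\<Inter>(I \<union> J)"] imageI) auto
  qed
  then show "\<exists>\<J>. \<J> \<noteq> {} \<and> finite \<J> \<and> \<J> \<subseteq> \<K> \<and> \<Inter>\<J> \<subseteq> U" by auto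
qed

end
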